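(* Let $\{k_n\}_{n=0}^\infty$ be a building sequence of the family of random multi-hooking networks $\{G_n\}_{n\ge 1}$ grown from a seed $G_0$ with $\tau_0\ge 2$ vertices and $\eta$ edges. Let $Y_n$ be the degree of a uniformly randomly chosen node of the graph $G_n$ at age $n$. Then $$\lim_{n\to\infty}\mathbb{E}[Y_n]=\frac{2\eta}{\tau_0-1}.$$
   Context: Seed. $G_0$ is a connected finite graph (loops and multiple edges are allowed; a loop contributes 2 to the degree of its vertex) with $\tau_0\ge 2$ vertices and $\eta$ edges; one vertex is designated as the hook $h$. Building sequence. A sequence of integers $\{k_n\}_{n=0}^\infty$ with $k_n\ge 1$ is a building sequence (for a seed of order $\tau_0$) if: (i) $k_n\le \tau_0+(\tau_0-1)\sum_{i=0}^{n-1}k_i$ for all $n\ge 0$; (ii) the limit $a:=\lim_{n\to\infty} k_n/\sum_{i=0}^n k_i$ exists in $[0,1]$; (iii) the limit $b:=\lim_{n\to\infty}\tau_0/k_n\ge 0$ exists. Random multi-hooking network. For $n\ge 1$, given $G_{n-1}=(V_{n-1},\mathcal{E}_{n-1})$, a set of $k_{n-1}$ distinct vertices of $G_{n-1}$, called latches, is chosen uniformly at random among all subsets of $V_{n-1}$ of size $k_{n-1}$ (given the whole past). For each latch a fresh copy of the seed is taken and its hook is fused (identified) with the latch; distinct latches receive distinct copies. The result is $G_n$. *)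

theory Defs
  imports "HOL-Probability.Probability" "HOL-Library.Uprod"
begin

text \<open>Finite undirected multigraphs: parallel edges are counted by the multiset, and a loop
  at \<open>v\<close> is the unordered pair \<open>Upair v v\<close>.\<close>

record 'v mgraph =
  verts :: "'v set"
  edges :: "'v uprod multiset"

definition finite_mgraph :: "'v mgraph \<Rightarrow> bool" where
  "finite_mgraph G \<longleftrightarrow> finite (verts G) \<and> (\<forall>e\<in>#edges G. set_uprod e \<subseteq> verts G)"

definition connected_mgraph :: "'v mgraph \<Rightarrow> bool" where
  "connected_mgraph G \<longleftrightarrow> verts G \<noteq> {} \<and>
     (\<forall>u\<in>verts G. \<forall>v\<in>verts G. (u, v) \<in> {(x, y). Upair x y \<in># edges G}\<^sup>*)"

text \<open>The second summand makes a loop contribute 2.\<close>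

definition degree :: "'v mgraph \<Rightarrow> 'v \<Rightarrow> nat" where
  "degree G v = size {#e \<in># edges G. v \<in> set_uprod e#} + count (edges G) (Upair v v)"

definition seed :: "'v mgraph \<Rightarrow> 'v \<Rightarrow> bool" where
  "seed G h \<longleftrightarrow> finite_mgraph G \<and> connected_mgraph G \<and> card (verts G) \<ge> 2 \<and> h \<in> verts G"

text \<open>The first argument is the order of the seed; it is at least 2 in every use, so the
  subtraction on natural numbers does not truncate.\<close>

definition building_sequence :: "nat \<Rightarrow> (nat \<Rightarrow> nat) \<Rightarrow> bool" where
  "building_sequence t k \<longleftrightarrow>
     (\<forall>n. k n \<ge> 1) \<and>
     (\<forall>n. k n \<le> t + (t - 1) * (\<Sum>i<n. k i)) \<and>
     (\<exists>a\<in>{0..1::real}. (\<lambda>n. real (k n) / real (\<Sum>i\<le>n. k i)) \<longlonglongrightarrow> a) \<and>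
     (\<exists>b\<ge>0::real. (\<lambda>n. real t / real (k n)) \<longlonglongrightarrow> b)"

text \<open>Names for the nodes of the network: \<open>Root v\<close> is a node of the initial graph, and
  \<open>Fresh n l v\<close> is the non-hook node \<open>v\<close> of the copy of the seed that is hooked to the latch \<open>l\<close>
  in the step from age \<open>n\<close> to age \<open>n + 1\<close>.  Hence copies made at different steps or for different
  latches share no new nodes.\<close>

datatype 'v node = Root 'v | Fresh nat "'v node" 'v

definition copy_node :: "'v \<Rightarrow> nat \<Rightarrow> 'v node \<Rightarrow> 'v \<Rightarrow> 'v node" where
  "copy_node h n l v = (if v = h then l else Fresh n l v)"

definition hook_copies ::
  "'v mgraph \<Rightarrow> 'v \<Rightarrow> nat \<Rightarrow> 'v node set \<Rightarrow> 'v node mgraph \<Rightarrow> 'v node mgraph" where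
  "hook_copies S h n L G =
     \<lparr>verts = verts G \<union> (\<Union>l\<in>L. copy_node h n l ` verts S),
      edges = edges G + (\<Sum>l\<in>L. image_mset (map_uprod (copy_node h n l)) (edges S))\<rparr>"

text \<open>The law of the random network of age \<open>n\<close>.  The names of its nodes record all previous
  choices of latches, so choosing uniformly given the current network is choosing uniformly
  given the whole past.\<close>

primrec network :: "'v mgraph \<Rightarrow> 'v \<Rightarrow> (nat \<Rightarrow> nat) \<Rightarrow> nat \<Rightarrow> 'v node mgraph pmf" where
  "network S h k 0 =
     return_pmf \<lparr>verts = Root ` verts S, edges = image_mset (map_uprod Root) (edges S)\<rparr>"
| "network S h k (Suc n) =
     bind_pmf (network S h k n) (\<lambda>G.
       map_pmf (\<lambda>L. hook_copies S h n L G) (pmf_of_set {L. L \<subseteq> verts G \<and> card L = k n}))"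

text \<open>The law of the degree of a node chosen uniformly from the network of age \<open>n\<close>.\<close>

definition random_node_degree :: "'v mgraph \<Rightarrow> 'v \<Rightarrow> (nat \<Rightarrow> nat) \<Rightarrow> nat \<Rightarrow> nat pmf" where
  "random_node_degree S h k n =
     bind_pmf (network S h k n) (\<lambda>G. map_pmf (degree G) (pmf_of_set (verts G)))"

end

theory Submission
  imports Defs "HOL-Real_Asymp.Real_Asymp"
begin

text \<open>The orders and sizes of the networks are deterministic: with
  \<open>K\<^sub>n = (\<Sum>i<n. k i)\<close> latches used so far, every network of age \<open>n\<close> has
  \<open>\<tau>\<^sub>0 + (\<tau>\<^sub>0 - 1) K\<^sub>n\<close> nodes and \<open>\<eta> (1 + K\<^sub>n)\<close> edges.  By the handshake lemma its average degree
  is therefore a fixed quotient, whatever the latches, and \<open>K\<^sub>n \<ge> n\<close> tends to infinity.\<close>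

text \<open>One edge adds exactly 2 to the total degree: an edge with distinct ends is counted once
  at each of them, while a loop is counted at its single end by both summands.\<close>

lemma sum_set_uprod_loop:
  assumes "finite V" "set_uprod e \<subseteq> V"
  shows "(\<Sum>v\<in>V. of_bool (v \<in> set_uprod e) + of_bool (e = Upair v v)) = (2::nat)"
proof (cases e)
  case (Upair a b)
  have "{v \<in> V. v \<in> set_uprod e} = {a, b}" "{v \<in> V. e = Upair v v} = (if a = b then {a} else {})"
    using assms Upair by auto
  then show ?thesis
    using assms(1) by (simp add: sum.distrib of_bool_def sum.If_cases Int_def conj_commute)
qed

lemma handshake:
  assumes "finite_mgraph G"
  shows "(\<Sum>v\<in>verts G. degree G v) = 2 * size (edges G)"
proof -
  \<comment> \<open>The vertex set and the edge multiset are decoupled from \<open>G\<close>, so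
    that the induction can remove edges while \<open>V\<close> stays fixed.\<close>
  have "(\<Sum>v\<in>V. size {#e \<in># E. v \<in> set_uprod e#} + count E (Upair v v)) = 2 * size E"
    if "finite V" "\<forall>e\<in>#E. set_uprod e \<subseteq> V" for V :: "'a set" and E
    using that(2)
  proof (induction E)
    case (add e E)
    have "(\<Sum>v\<in>V. size {#e' \<in># add_mset e E. v \<in> set_uprod e'#} + count (add_mset e E) (Upair v v))
        = (\<Sum>v\<in>V. (of_bool (v \<in> set_uprod e) + of_bool (e = Upair v v)) +
             (size {#e \<in># E. v \<in> set_uprod e#} + count E (Upair v v)))"
      by (intro sum.cong) auto
    then show ?case
      \<comment> \<open>The instance of \<open>sum.distrib\<close> splits only the outer sum and
        keeps the bracket of the new edge whole, ready for
        \<open>sum_set_uprod_loop\<close>.\<close>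
      using add sum_set_uprod_loop[OF that(1), of e] by (simp add: sum.distrib[where g = "\<lambda>v. _ v + _ v"])
  qed simp
  with assms show ?thesis
    by (simp add: finite_mgraph_def degree_def)
qed

text \<open>The step index in a \<open>Fresh\<close> name serves as a birth date. In a network of
  age \<open>n\<close> all dates are below \<open>n\<close>, so the nodes added next, dated
  \<open>n\<close>, are new.\<close>

primrec born_before :: "nat \<Rightarrow> 'v node \<Rightarrow> bool" where
  "born_before n (Root v) \<longleftrightarrow> True"
| "born_before n (Fresh m l v) \<longleftrightarrow> m < n"

lemma born_before_Suc: "born_before n x \<Longrightarrow> born_before (Suc n) x"
  by (cases x) auto

text \<open>The hook of each copy is its latch, which already lies in \<open>G\<close>; only the
  non-hook nodes enlarge the vertex set, one for each pair of a latch and such a node.\<close>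

lemma verts_hook_copies:
  assumes "h \<in> verts S" "L \<subseteq> verts G"
  shows "verts (hook_copies S h n L G)
    = verts G \<union> (\<lambda>(l, v). Fresh n l v) ` (L \<times> (verts S - {h}))"
  using assms by (auto simp: hook_copies_def copy_node_def image_iff)

lemma card_verts_hook_copies:
  assumes "finite (verts S)" "h \<in> verts S" "finite (verts G)" "L \<subseteq> verts G"
    and "\<forall>x\<in>verts G. born_before n x"
  shows "card (verts (hook_copies S h n L G)) = card (verts G) + (card (verts S) - 1) * card L"
proof -
  have "finite L" using assms finite_subset by blast
  have "verts G \<inter> (\<lambda>(l, v). Fresh n l v) ` (L \<times> (verts S - {h})) = {}"
    using assms(5) by fastforce
  moreover have "inj_on (\<lambda>(l, v). Fresh n l v) (L \<times> (verts S - {h}))"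
    by (auto simp: inj_on_def)
  ultimately show ?thesis
    using assms \<open>finite L\<close>
    by (simp add: verts_hook_copies card_Un_disjoint card_image card_cartesian_product)
qed

lemma size_edges_hook_copies:
  "size (edges (hook_copies S h n L G)) = size (edges G) + card L * size (edges S)"
  by (simp add: hook_copies_def size_multiset_sum)

lemma finite_mgraph_hook_copies:
  assumes "finite_mgraph S" "finite_mgraph G" "finite L"
  shows "finite_mgraph (hook_copies S h n L G)"
proof -
  have "\<exists>l\<in>L. \<exists>e\<in>#edges S. x = map_uprod (copy_node h n l) e"
    if "x \<in># (\<Sum>l\<in>L. image_mset (map_uprod (copy_node h n l)) (edges S))" for x
    using that assms(3) by (auto simp: set_mset_sum)
  then show ?thesis
    using assms unfolding finite_mgraph_def hook_copies_def
    by (fastforce simp: uprod.set_map)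
qed

text \<open>The claims support each other in the induction: the order of the network makes the next
  choice of latches possible, and the birth dates make the count of new nodes exact.\<close>

lemma network_invariant:
  assumes S: "finite_mgraph S" "h \<in> verts S" and t: "card (verts S) = t"
    and k: "\<And>n. k n \<le> t + (t - 1) * (\<Sum>i<n. k i)"
    and G: "G \<in> set_pmf (network S h k n)"
  shows "finite_mgraph G \<and> (\<forall>x\<in>verts G. born_before n x) \<and>
    card (verts G) = t + (t - 1) * (\<Sum>i<n. k i) \<and>
    size (edges G) = size (edges S) * (1 + (\<Sum>i<n. k i))"
  using G
proof (induction n arbitrary: G)
  case 0
  then show ?case
    using S t by (auto simp: finite_mgraph_def uprod.set_map card_image inj_on_def)
next
  case (Suc n)
  then obtain H L where H: "H \<in> set_pmf (network S h k n)"
    and L: "L \<in> set_pmf (pmf_of_set {L. L \<subseteq> verts H \<and> card L = k n})"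
    and G: "G = hook_copies S h n L H"
    by auto
  note IH = Suc.IH[OF H]
  have fin: "finite (verts H)" using IH by (simp add: finite_mgraph_def)
  \<comment> \<open>The bound on \<open>k n\<close> is exactly the order of \<open>H\<close>. Hence
    a latch set exists, and the support of \<open>pmf_of_set\<close>, known only for a finite
    nonempty set, is the intended family.\<close>
  have "k n \<le> card (verts H)" using k[of n] IH by simp
  then obtain T where "T \<subseteq> verts H" "card T = k n"
    by (rule obtain_subset_with_card_n)
  then have "{L. L \<subseteq> verts H \<and> card L = k n} \<noteq> {}" by blast
  with L fin have L: "L \<subseteq> verts H" "card L = k n"
    by auto
  then have "finite L" using fin finite_subset by blast
  have "\<forall>x\<in>verts G. born_before (Suc n) x"
    using IH by (auto simp: G verts_hook_copies[OF S(2) L(1)] born_before_Suc)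
  then show ?case
    using IH S L fin t \<open>finite L\<close> unfolding G
    by (simp add: finite_mgraph_hook_copies card_verts_hook_copies size_edges_hook_copies
        finite_mgraph_def[of S] algebra_simps)
qed

text \<open>Given the network, the mean degree is the same constant on the whole support, so
  averaging over networks does not change it.\<close>

lemma expectation_random_node_degree:
  assumes S: "finite_mgraph S" "h \<in> verts S" and t: "card (verts S) = t"
    and k: "\<And>n. k n \<le> t + (t - 1) * (\<Sum>i<n. k i)"
  shows "measure_pmf.expectation (random_node_degree S h k n) real =
    2 * real (size (edges S)) * (1 + real (\<Sum>i<n. k i)) / (real t + (real t - 1) * real (\<Sum>i<n. k i))"
    (is "_ = ?c")
proof -
  have "t > 0"
    using S t by (auto simp: finite_mgraph_def card_gt_0_iff)
  \<comment> \<open>Nonnegative integrals pass through \<open>bind_pmf\<close> without integrability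
    conditions; the return to real expectations comes at the end.\<close>
  have "(\<integral>\<^sup>+v. ennreal (real (degree G v)) \<partial>pmf_of_set (verts G)) = ennreal ?c"
    if G: "G \<in> set_pmf (network S h k n)" for G
  proof -
    note inv = network_invariant[OF S t k G]
    have "finite (verts G)" "card (verts G) > 0"
      using inv \<open>t > 0\<close> by (auto simp: finite_mgraph_def)
    then have "(\<integral>\<^sup>+v. ennreal (real (degree G v)) \<partial>pmf_of_set (verts G))
        = ennreal (real (\<Sum>v\<in>verts G. degree G v) / real (card (verts G)))"
      by (subst nn_integral_pmf_of_set)
        (simp_all only: card_gt_0_iff sum_ennreal of_nat_0_le_iff of_nat_0_less_iff of_nat_sum sum_nonneg
          divide_ennreal ennreal_of_nat_eq_real_of_nat not_False_eq_True)
    also have "real (\<Sum>v\<in>verts G. degree G v) / real (card (verts G)) = ?c"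
      using inv \<open>t > 0\<close> by (simp add: handshake of_nat_diff distrib_left del: of_nat_sum)
    finally show ?thesis .
  qed
  then have "(\<integral>\<^sup>+x. ennreal (real x) \<partial>random_node_degree S h k n)
      = (\<integral>\<^sup>+G. ennreal ?c \<partial>network S h k n)"
    unfolding random_node_degree_def nn_integral_bind_pmf nn_integral_map_pmf
    by (intro nn_integral_cong_AE) (auto simp: AE_measure_pmf_iff)
  moreover have "?c \<ge> 0"
    using \<open>t > 0\<close> by (intro divide_nonneg_nonneg add_nonneg_nonneg mult_nonneg_nonneg) (auto simp: sum_nonneg)
  ultimately show ?thesis
    by (simp add: integral_eq_nn_integral measure_pmf.emeasure_space_1 del: of_nat_sum)
qed

theorem theorem4p2:
  fixes G\<^sub>0 :: "'v mgraph" and h :: 'v and k :: "nat \<Rightarrow> nat" and \<tau>\<^sub>0 \<eta> :: nat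
  assumes "seed G\<^sub>0 h"
    and "card (verts G\<^sub>0) = \<tau>\<^sub>0"
    and "size (edges G\<^sub>0) = \<eta>"
    and "building_sequence \<tau>\<^sub>0 k"
  shows "(\<lambda>n. measure_pmf.expectation (random_node_degree G\<^sub>0 h k n) real)
           \<longlonglongrightarrow> 2 * real \<eta> / (real \<tau>\<^sub>0 - 1)"
proof -
  let ?f = "\<lambda>x::real. 2 * real \<eta> * (1 + x) / (real \<tau>\<^sub>0 + (real \<tau>\<^sub>0 - 1) * x)"
  have \<tau>: "real \<tau>\<^sub>0 - 1 > 0" and k: "\<And>n. k n \<ge> 1"
      "\<And>n. k n \<le> \<tau>\<^sub>0 + (\<tau>\<^sub>0 - 1) * (\<Sum>i<n. k i)"
    using assms by (auto simp: seed_def building_sequence_def)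
  have eq: "measure_pmf.expectation (random_node_degree G\<^sub>0 h k n) real = ?f (real (\<Sum>i<n. k i))" for n
    using expectation_random_node_degree[OF _ _ assms(2) k(2)] assms(1,3) by (simp add: seed_def)
  have "real n \<le> real (\<Sum>i<n. k i)" for n
    using sum_mono[of "{..<n}" "\<lambda>_. 1" k] k(1) by (simp del: of_nat_sum)
  then have lim: "filterlim (\<lambda>n. real (\<Sum>i<n. k i)) at_top sequentially"
    by (intro filterlim_at_top_mono[OF filterlim_real_sequentially]) auto
  \<comment> \<open>The limit is the quotient of the leading coefficients in \<open>x\<close>; the
    one in the denominator is positive by \<open>\<tau>\<close>.\<close>
  have "(?f \<longlongrightarrow> 2 * real \<eta> / (real \<tau>\<^sub>0 - 1)) at_top"
    unfolding divide_inverse[of _ "real \<tau>\<^sub>0 - 1"] using \<tau> by real_asymp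
  from filterlim_compose[OF this lim] show ?thesis
    unfolding eq .
qed

end
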